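(* Let $\phi \in C^1(\mathbb{R}^2,\mathbb{R})$ be strictly star-shaped, i.e. $x\,\frac{\partial \phi}{\partial x}(x,y) + y\,\frac{\partial \phi}{\partial y}(x,y) \neq 0$ for all $(x,y)\neq(0,0)$. Then the planar system $$\dot x = y, \qquad \dot y = -x - y\,\phi(x,y)$$ has at most one limit cycle.
   Context: A limit cycle of a planar autonomous system means the orbit (closed curve) of a non-constant periodic solution. Two periodic solutions with the same orbit (differing by a time translation) determine the same limit cycle. *)

theory Defs
  imports "HOL-Analysis.Analysis"
begin

definition C1_on_plane :: "(real \<times> real \<Rightarrow> real) \<Rightarrow> bool" where
  "C1_on_plane \<phi> \<longleftrightarrow>
     (\<exists>\<phi>' :: real \<times> real \<Rightarrow> (real \<times> real) \<Rightarrow>\<^sub>L real.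
        (\<forall>p. (\<phi> has_derivative blinfun_apply (\<phi>' p)) (at p)) \<and> continuous_on UNIV \<phi>')"

definition partial_x :: "(real \<times> real \<Rightarrow> real) \<Rightarrow> real \<Rightarrow> real \<Rightarrow> real" where
  "partial_x \<phi> x y = deriv (\<lambda>s. \<phi> (s, y)) x"

definition partial_y :: "(real \<times> real \<Rightarrow> real) \<Rightarrow> real \<Rightarrow> real \<Rightarrow> real" where
  "partial_y \<phi> x y = deriv (\<lambda>s. \<phi> (x, s)) y"

definition strictly_star_shaped :: "(real \<times> real \<Rightarrow> real) \<Rightarrow> bool" where
  "strictly_star_shaped \<phi> \<longleftrightarrow>
     (\<forall>x y. (x, y) \<noteq> (0, 0) \<longrightarrow> x * partial_x \<phi> x y + y * partial_y \<phi> x y \<noteq> 0)"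

definition solution :: "(real \<times> real \<Rightarrow> real \<times> real) \<Rightarrow> (real \<Rightarrow> real \<times> real) \<Rightarrow> bool" where
  "solution F z \<longleftrightarrow> (\<forall>t. (z has_vector_derivative F (z t)) (at t))"

definition periodic :: "(real \<Rightarrow> 'a) \<Rightarrow> bool" where
  "periodic z \<longleftrightarrow> (\<exists>T>0. \<forall>t. z (t + T) = z t)"

text \<open>
  A limit cycle is the orbit as a point set, so time translates of a periodic solution
  determine the same limit cycle. It is not required to be isolated among closed orbits.
\<close>

definition limit_cycle :: "(real \<times> real \<Rightarrow> real \<times> real) \<Rightarrow> (real \<times> real) set \<Rightarrow> bool" where
  "limit_cycle F C \<longleftrightarrow>
     (\<exists>z. solution F z \<and> periodic z \<and> \<not> z constant_on UNIV \<and> C = range z)"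

definition planar_field :: "(real \<times> real \<Rightarrow> real) \<Rightarrow> real \<times> real \<Rightarrow> real \<times> real" where
  "planar_field \<phi> = (\<lambda>(x, y). (y, - x - y * \<phi> (x, y)))"

end

theory Submission imports Defs "HOL-Library.Periodic_Fun" begin

text \<open>
  Along a non-constant periodic orbit put \<open>a = x\<^sup>2 + y\<^sup>2 + x y \<phi>\<close>, so that \<open>-a / r\<^sup>2\<close> is the angular
  velocity. Where \<open>a\<close> vanishes the field is radial and the derivative of \<open>a\<close> is \<open>y\<^sup>2\<close> times the
  radial derivative of \<open>\<phi>\<close>, which has constant sign; as \<open>a > 0\<close> where \<open>y = 0\<close>, periodicity forces
  \<open>a > 0\<close> throughout. The orbit is therefore a graph \<open>r = exp (\<rho> \<theta>)\<close> over the angle, with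
  \<open>\<rho>' = sin\<^sup>2 \<theta> \<phi> / (1 + sin \<theta> cos \<theta> \<phi>)\<close>, whose right-hand side is monotone in \<open>\<phi>\<close>, hence in \<open>\<rho>\<close>.
  For two such orbits the squared difference of the \<open>\<rho>\<close>'s is then both monotone and periodic, so it
  is constant, and \<open>\<rho>\<^sub>1 = \<rho>\<^sub>2\<close>.
\<close>

section \<open>Periodic real functions and their zeros\<close>

text \<open>Supplies the angle along an orbit as an integral of its angular velocity over the whole
  line.\<close>

lemma real_antiderivative:
  fixes f :: "real \<Rightarrow> real"
  assumes "\<And>t. isCont f t"
  obtains F where "\<And>t. (F has_real_derivative f t) (at t)"
  using einterval_antiderivative[of "-\<infinity>" "\<infinity>" f] assms
  by (auto simp: has_real_derivative_iff_has_vector_derivative)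

lemma periodic_of_nat:
  fixes f :: "real \<Rightarrow> 'a"
  assumes "\<And>t. f (t + T) = f t"
  shows "f (t + of_nat n * T) = f t"
proof -
  interpret periodic_fun_simple f T by standard (rule assms)
  show ?thesis by (rule plus_of_nat)
qed

lemma periodic_beyond:
  fixes f :: "real \<Rightarrow> 'a"
  assumes "\<And>t. f (t + T) = f t" and "T > 0"
  obtains u where "u > s" and "f u = f t"
proof -
  obtain n :: nat where n: "of_nat n * T > s - t"
    using reals_Archimedean3[OF \<open>T > 0\<close>] by blast
  show thesis
    using that[of "t + of_nat n * T"] periodic_of_nat[of f T, OF assms(1)] n by simp
qed

lemma periodic_mono_const:
  fixes f :: "real \<Rightarrow> real"
  assumes per: "\<And>t. f (t + T) = f t" and T: "T > 0" and "mono f"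
  shows "f s = f t"
proof -
  have le: "f s \<le> f t" for s t
    using periodic_beyond[of f T s t, OF per T] \<open>mono f\<close>
    by (metis less_imp_le monoD)
  show ?thesis using le[of s t] le[of t s] by simp
qed

text \<open>At a first zero after \<open>t0\<close> the function would be increasing, hence negative
  shortly before; the intermediate value theorem then yields a still earlier zero.\<close>

lemma positive_of_upward_zeros:
  fixes f f' :: "real \<Rightarrow> real"
  assumes der: "\<And>t. (f has_real_derivative f' t) (at t)"
    and up: "\<And>t. f t = 0 \<Longrightarrow> f' t > 0"
    and pos: "f t0 > 0" and "t0 \<le> t"
  shows "f t > 0"
proof (rule ccontr)
  assume neg: "\<not> f t > 0"
  have cont: "continuous_on A f" for A
    using der DERIV_isCont continuous_at_imp_continuous_on by blast
  define Z where "Z = {t0..t} \<inter> f -` {0}"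
  have "compact Z"
    unfolding Z_def using cont by (intro compact_Int_closed closed_vimage) auto
  moreover have "Z \<noteq> {}"
    using IVT2'[of f t 0 t0, OF _ _ _ cont] neg pos \<open>t0 \<le> t\<close> by (auto simp: Z_def not_less)
  ultimately obtain s where s: "s \<in> Z" and min: "\<And>u. u \<in> Z \<Longrightarrow> s \<le> u"
    using compact_attains_inf[of Z] by blast
  have "f s = 0" "t0 \<le> s" "s \<le> t" using s by (auto simp: Z_def)
  with pos have "t0 < s" by (cases "t0 = s") auto
  obtain d where "d > 0" and d: "\<And>h. 0 < h \<Longrightarrow> h < d \<Longrightarrow> f (s - h) < f s"
    using DERIV_pos_inc_left[OF der up[OF \<open>f s = 0\<close>]] by blast
  \<comment> \<open>Halving \<open>d\<close> makes \<open>h < d\<close> strict, and the second bound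
    keeps \<open>s - h\<close> from falling before \<open>t0\<close>.\<close>
  define h where "h = min (d / 2) (s - t0)"
  have h: "0 < h" "h < d" "t0 \<le> s - h"
    using \<open>d > 0\<close> \<open>t0 < s\<close> by (auto simp: h_def)
  then have "f (s - h) \<le> 0" using d \<open>f s = 0\<close> by fastforce
  then obtain u where "t0 \<le> u" "u \<le> s - h" "f u = 0"
    using IVT2'[of f "s - h" 0 t0, OF _ _ _ cont] pos h by auto
  with min[of u] h \<open>s \<le> t\<close> show False by (auto simp: Z_def)
qed

text \<open>Periodicity lets the positive value at \<open>t0\<close> be placed before
  \<open>t\<close>, or after it. The second choice serves zeros that are crossed downward: reversing
  time turns them into upward ones.\<close>

lemma periodic_positive:
  fixes f f' :: "real \<Rightarrow> real"
  assumes der: "\<And>t. (f has_real_derivative f' t) (at t)"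
    and per: "\<And>t. f (t + T) = f t" and T: "T > 0"
    and sgn: "\<And>t. f t = 0 \<Longrightarrow> \<sigma> * f' t > 0"
    and pos: "f t0 > 0"
  shows "f t > 0"
proof (cases "\<sigma> > 0")
  case True
  then have up: "f t = 0 \<Longrightarrow> f' t > 0" for t
    using sgn[of t] by (simp add: zero_less_mult_iff)
  obtain u where "u > t0" "f u = f t" using periodic_beyond[of f T t0 t, OF per T] .
  then show ?thesis using positive_of_upward_zeros[of f f', OF der up pos, of u] by simp
next
  case False
  then have down: "f t = 0 \<Longrightarrow> - f' t > 0" for t
    using sgn[of t] by (auto simp: zero_less_mult_iff)
  have der': "((\<lambda>t. f (- t)) has_real_derivative - f' (- t)) (at t)" for t
    using DERIV_chain2[OF der DERIV_minus[OF DERIV_ident]] by simp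
  obtain u where "u > t" "f u = f t0" using periodic_beyond[of f T t t0, OF per T] .
  then show ?thesis
    using positive_of_upward_zeros[of "\<lambda>t. f (- t)" "\<lambda>t. - f' (- t)", OF der' down, of "-u" "-t"] pos
    by simp
qed

section \<open>Polar coordinates and the damping function\<close>

text \<open>The hypotheses say that turning (x, y) back by the angle with cosine \<open>c\<close>
  and sine \<open>s\<close> gives (r, 0); turning forward again recovers (x, y).\<close>

lemma unrotate:
  fixes x y c s r :: real
  assumes "c * c + s * s = 1" "x * c + y * s = r" "y * c = x * s"
  shows "x = r * c" and "y = r * s"
proof -
  have "r * c = x * (c * c) + (y * c) * s" "r * s = (x * s) * c + y * (s * s)"
    by (simp_all flip: assms(2) add: algebra_simps)
  moreover have "x * (c * c) + (y * c) * s = x * (c * c + s * s)"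
    unfolding assms(3) by (simp only: algebra_simps)
  moreover have "(x * s) * c + y * (s * s) = y * (c * c + s * s)"
    unfolding assms(3)[symmetric] by (simp only: algebra_simps)
  ultimately show "x = r * c" "y = r * s" by (simp_all add: assms(1))
qed

text \<open>\<open>\<phi>' p p\<close> is the derivative at \<open>p\<close> in the direction of
  \<open>p\<close> itself, that is, r times the radial derivative. The factor
  \<open>\<sigma>\<close> carries its constant sign, so that increasing and decreasing \<phi> are
  treated together.\<close>

locale star_shaped_damping =
  fixes \<phi> :: "real \<times> real \<Rightarrow> real" and \<phi>' :: "real \<times> real \<Rightarrow> real \<times> real \<Rightarrow> real" and \<sigma> :: real
  assumes \<phi>_deriv: "(\<phi> has_derivative \<phi>' p) (at p)"
    and radial: "p \<noteq> (0, 0) \<Longrightarrow> \<sigma> * \<phi>' p p > 0"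
begin

lemma isCont_\<phi>: "isCont \<phi> p"
  using \<phi>_deriv has_derivative_continuous by blast

lemma \<phi>'_scale: "\<phi>' p (c * x, c * y) = c * \<phi>' p (x, y)"
  using linear_scale[OF has_derivative_linear[OF \<phi>_deriv], of p c "(x, y)"] by simp

lemma \<phi>_chain:
  assumes "(x has_real_derivative x') (at t)" "(y has_real_derivative y') (at t)"
  shows "((\<lambda>t. \<phi> (x t, y t)) has_real_derivative \<phi>' (x t, y t) (x', y')) (at t)"
proof -
  have "((\<lambda>t. (x t, y t)) has_derivative (\<lambda>h. (x' * h, y' * h))) (at t)"
    using assms by (auto simp: has_field_derivative_def intro!: has_derivative_Pair)
  from has_derivative_compose[OF this \<phi>_deriv] show ?thesis
    by (rule has_derivative_imp_has_field_derivative) (metis \<phi>'_scale mult.commute)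
qed

text \<open>With the logarithm of the radius as coordinate, the derivative in \<rho> at a fixed
  angle is exactly \<open>\<phi>' p p\<close>, and every real \<rho> gives a point off the
  origin.\<close>

definition polar :: "real \<Rightarrow> real \<Rightarrow> real" where
  "polar \<rho> s = \<phi> (exp \<rho> * cos s, exp \<rho> * sin s)"

text \<open>The quotient of the rate of ln r, which is -sin^2 \<phi>, by the angular velocity -(1 +
  sin cos \<phi>). Positivity of the denominator means clockwise rotation.\<close>

definition polar_solution :: "(real \<Rightarrow> real) \<Rightarrow> bool" where
  "polar_solution \<rho> \<longleftrightarrow> (\<forall>s. 1 + sin s * cos s * polar (\<rho> s) s > 0 \<and>
     (\<rho> has_real_derivative
       (sin s)\<^sup>2 * polar (\<rho> s) s / (1 + sin s * cos s * polar (\<rho> s) s)) (at s))"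

lemma polar_mono:
  assumes "\<rho>1 \<noteq> \<rho>2"
  shows "\<sigma> * (polar \<rho>1 s - polar \<rho>2 s) * (\<rho>1 - \<rho>2) > 0"
proof -
  define g where "g \<rho> = \<sigma> * polar \<rho> s" for \<rho>
  have der: "\<exists>D. (g has_real_derivative D) (at \<rho>) \<and> D > 0" for \<rho>
  proof -
    let ?p = "(exp \<rho> * cos s, exp \<rho> * sin s)"
    have "cos s \<noteq> 0 \<or> sin s \<noteq> 0" using sin_zero_abs_cos_one[of s] by fastforce
    then have "\<sigma> * \<phi>' ?p ?p > 0" by (intro radial) simp
    moreover have "(g has_real_derivative \<sigma> * \<phi>' ?p ?p) (at \<rho>)"
      unfolding g_def polar_def by (intro DERIV_cmult \<phi>_chain) (auto intro!: derivative_eq_intros)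
    ultimately show ?thesis by blast
  qed
  have mono: "g r < g r'" if "r < r'" for r r'
    using DERIV_pos_imp_increasing[OF that] der by blast
  have "(g \<rho>1 - g \<rho>2) * (\<rho>1 - \<rho>2) > 0"
    using assms mono[of \<rho>1 \<rho>2] mono[of \<rho>2 \<rho>1]
    by (cases "\<rho>1 < \<rho>2") (auto simp: zero_less_mult_iff)
  then show ?thesis by (simp add: g_def algebra_simps)
qed

end

section \<open>Closed orbits avoid the origin and turn clockwise\<close>

locale closed_orbit = star_shaped_damping +
  fixes x y :: "real \<Rightarrow> real" and T :: real
  assumes x_deriv: "(x has_real_derivative y t) (at t)"
    and y_deriv: "(y has_real_derivative - x t - y t * \<phi> (x t, y t)) (at t)"
    and T_pos: "T > 0"
    and x_periodic: "x (t + T) = x t"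
    and y_periodic: "y (t + T) = y t"
    and nonconstant: "\<not> (\<lambda>t. (x t, y t)) constant_on UNIV"
begin

lemma isCont_orbit: "isCont x t" "isCont y t" "isCont (\<lambda>t. \<phi> (x t, y t)) t"
proof -
  show xy: "isCont x t" "isCont y t" using x_deriv y_deriv DERIV_isCont by blast+
  show "isCont (\<lambda>t. \<phi> (x t, y t)) t"
    using xy by (intro isCont_o2[OF _ isCont_\<phi>] continuous_intros)
qed

text \<open>A Gronwall argument: if |\<phi>| \<le> M along the orbit on the interval, then x^2 + y^2
  grows at rate at most 2M times itself, so its product with exp (-2Mu) cannot increase from
  0.\<close>

lemma zero_forward:
  assumes "x s = 0" "y s = 0" "s \<le> t"
  shows "x t = 0 \<and> y t = 0"
proof -
  have "compact ((\<lambda>t. \<phi> (x t, y t)) ` {s..t})"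
    by (intro compact_continuous_image continuous_at_imp_continuous_on) (auto intro: isCont_orbit)
  then obtain M where M: "\<And>u. u \<in> {s..t} \<Longrightarrow> \<bar>\<phi> (x u, y u)\<bar> \<le> M"
    using compact_imp_bounded bounded_real by (metis (no_types, lifting) image_eqI)
  define f where "f u = ((x u)\<^sup>2 + (y u)\<^sup>2) * exp (- 2 * M * u)" for u
  have "f t \<le> f s"
  proof (rule DERIV_nonpos_imp_nonincreasing[OF \<open>s \<le> t\<close>])
    fix u assume u: "s \<le> u" "u \<le> t"
    let ?D = "- 2 * ((y u)\<^sup>2 * (M + \<phi> (x u, y u)) + M * (x u)\<^sup>2) * exp (- 2 * M * u)"
    have "(f has_real_derivative ?D) (at u)"
      unfolding f_def
      by (rule derivative_eq_intros x_deriv y_deriv refl | simp)+ (simp add: algebra_simps power2_eq_square)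
    moreover have "?D \<le> 0"
    proof -
      have "0 \<le> M + \<phi> (x u, y u)" "0 \<le> M" using M[of u] u by auto
      then have "0 \<le> (y u)\<^sup>2 * (M + \<phi> (x u, y u)) + M * (x u)\<^sup>2" by simp
      then show ?thesis by (intro mult_nonpos_nonneg) auto
    qed
    ultimately show "\<exists>D. (f has_real_derivative D) (at u) \<and> D \<le> 0" by blast
  qed
  then have "(x t)\<^sup>2 + (y t)\<^sup>2 \<le> 0"
    using assms by (simp add: f_def mult_le_0_iff)
  then show ?thesis by (simp add: sum_power2_le_zero_iff)
qed

text \<open>An orbit that meets the origin stays there from then on, and each of its points recurs
  at a later time, so it would be constant.\<close>

lemma orbit_nonzero: "(x t)\<^sup>2 + (y t)\<^sup>2 > 0"
proof (rule ccontr)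
  assume "\<not> ?thesis"
  then have 0: "x t = 0" "y t = 0" by (auto simp: sum_power2_gt_zero_iff)
  have "(x s, y s) = (0, 0)" for s
  proof -
    obtain u where "u > t" "(x u, y u) = (x s, y s)"
      using periodic_beyond[of "\<lambda>t. (x t, y t)" T t s] x_periodic y_periodic T_pos by auto
    then show ?thesis using zero_forward[OF 0, of u] by simp
  qed
  then show False using nonconstant by (auto simp: constant_on_def)
qed

lemma rotates: "(x t)\<^sup>2 + (y t)\<^sup>2 + x t * y t * \<phi> (x t, y t) > 0"
proof -
  define f where "f t = (x t)\<^sup>2 + (y t)\<^sup>2 + x t * y t * \<phi> (x t, y t)" for t
  define y' where "y' t = - x t - y t * \<phi> (x t, y t)" for t
  define f' where "f' t = 2 * x t * y t + 2 * y t * y' t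
      + (y t * y t + x t * y' t) * \<phi> (x t, y t) + x t * y t * \<phi>' (x t, y t) (y t, y' t)" for t
  have der: "(f has_real_derivative f' t) (at t)" for t
    unfolding f_def f'_def y'_def
    by (rule derivative_eq_intros \<phi>_chain x_deriv y_deriv refl | simp add: algebra_simps)+
  have per: "f (t + T) = f t" for t by (simp add: f_def x_periodic y_periodic)
  have sgn: "\<sigma> * f' t > 0" if "f t = 0" for t
  proof -
    have "x t \<noteq> 0" using that orbit_nonzero[of t] by (auto simp: f_def)
    have "y t \<noteq> 0" using that orbit_nonzero[of t] by (auto simp: f_def)
    \<comment> \<open>The identity x y' = y^2 - f shows that at a zero of \<open>f\<close> the
      velocity is y/x times the position, so \<open>\<phi>'\<close> is evaluated in the radial
      direction.\<close>
    have y': "y' t = y t / x t * y t"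
      using that \<open>x t \<noteq> 0\<close> by (simp add: f_def y'_def field_simps power2_eq_square)
    have "\<phi>' (x t, y t) (y t, y' t) = y t / x t * \<phi>' (x t, y t) (x t, y t)"
      using \<phi>'_scale[of "(x t, y t)" "y t / x t" "x t" "y t"] \<open>x t \<noteq> 0\<close> y' by simp
    then have "f' t = 2 * y t / x t * f t + (y t)\<^sup>2 * \<phi>' (x t, y t) (x t, y t)"
      unfolding f'_def f_def y' using \<open>x t \<noteq> 0\<close> by (simp add: field_simps power2_eq_square)
    then have "\<sigma> * f' t = (y t)\<^sup>2 * (\<sigma> * \<phi>' (x t, y t) (x t, y t))"
      using that by simp
    also have "\<dots> > 0" using radial[of "(x t, y t)"] \<open>y t \<noteq> 0\<close> by simp
    finally show ?thesis .
  qed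
  \<comment> \<open>Rolle over one period of \<open>x\<close> gives a time with x' = y = 0, where
    \<open>f\<close> reduces to x^2 + y^2.\<close>
  obtain t0 where "y t0 = 0"
  proof -
    have "\<exists>z>0. z < T \<and> DERIV x z :> 0"
      using x_periodic[of 0] T_pos x_deriv
      by (intro Rolle) (auto simp: real_differentiable_def intro!: continuous_at_imp_continuous_on isCont_orbit)
    then show thesis using that DERIV_unique[OF x_deriv] by blast
  qed
  then have "f t0 > 0" using orbit_nonzero[of t0] by (simp add: f_def)
  from periodic_positive[of f f', OF der per T_pos sgn this] show ?thesis by (simp add: f_def)
qed

section \<open>A closed orbit as a graph over the angle\<close>

text \<open>Time is exchanged for the angle, which is strictly monotone by \<open>rotates\<close>.
  \<open>N\<close> counts the turns made during time \<open>T\<close>, so the period in the angle is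
  a multiple of 2 pi.\<close>

lemma polar_graph:
  obtains \<rho> :: "real \<Rightarrow> real" and N :: nat where "N > 0"
    and "\<forall>s. \<rho> (s + of_nat N * (2 * pi)) = \<rho> s"
    and "range (\<lambda>t. (x t, y t)) = range (\<lambda>s. (exp (\<rho> s) * cos s, exp (\<rho> s) * sin s))"
    and "polar_solution \<rho>"
proof -
  define q where "q t = (x t)\<^sup>2 + (y t)\<^sup>2" for t
  define a where "a t = q t + x t * y t * \<phi> (x t, y t)" for t
  have q: "q t > 0" and a: "a t > 0" for t
    using orbit_nonzero[of t] rotates[of t] by (auto simp: q_def a_def)
  have "isCont (\<lambda>t. - a t / q t) t" for t
    using q[of t] unfolding a_def q_def by (intro continuous_intros isCont_orbit) auto
  \<comment> \<open>The angular velocity is (x y' - y x') / q, and its numerator equals -a.\<close>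
  then obtain \<theta>0 where \<theta>0: "\<And>t. (\<theta>0 has_real_derivative - a t / q t) (at t)"
    using real_antiderivative[of "\<lambda>t. - a t / q t"] by auto
  define R where "R t = ln (q t) / 2" for t
  have R_deriv: "(R has_real_derivative - (y t)\<^sup>2 * \<phi> (x t, y t) / q t) (at t)" for t
  proof -
    have "(q has_real_derivative - 2 * ((y t)\<^sup>2 * \<phi> (x t, y t))) (at t)"
      unfolding q_def
      by (rule derivative_eq_intros x_deriv y_deriv refl | simp add: algebra_simps power2_eq_square)+
    from DERIV_cdivide[OF DERIV_chain2[OF DERIV_ln[OF q] this], of 2] show ?thesis
      unfolding R_def by (simp add: field_simps)
  qed
  have expR: "exp (R t) * exp (R t) = q t" for t
    using q[of t] unfolding R_def by (simp flip: exp_add)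
  \<comment> \<open>\<open>\<alpha>\<close> is an angle of the initial point; it fixes the constant
    of integration.\<close>
  obtain \<alpha> where \<alpha>: "x 0 = exp (R 0) * cos \<alpha>" "y 0 = exp (R 0) * sin \<alpha>"
  proof -
    have "(x 0 / exp (R 0))\<^sup>2 + (y 0 / exp (R 0))\<^sup>2 = 1"
      using expR[of 0] q[of 0] by (auto simp: power_divide power2_eq_square q_def simp flip: add_divide_distrib)
    then obtain \<alpha> where "x 0 / exp (R 0) = cos \<alpha>" "y 0 / exp (R 0) = sin \<alpha>"
      using sincos_total_2pi by metis
    then show thesis using that[of \<alpha>] by (simp add: field_simps)
  qed
  define \<theta> where "\<theta> t = \<theta>0 t - \<theta>0 0 + \<alpha>" for t
  have \<theta>_deriv: "(\<theta> has_real_derivative - a t / q t) (at t)" for t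
    unfolding \<theta>_def by (rule derivative_eq_intros \<theta>0 refl | simp)+
  have xy_polar: "x t = exp (R t) * cos (\<theta> t)" "y t = exp (R t) * sin (\<theta> t)" for t
  proof -
    \<comment> \<open>(u, v) is the point scaled by 1/r and turned back by \<theta>. Both
      coordinates have derivative 0 and start at (1, 0), so the integrated angle is a true polar
      angle for all time.\<close>
    define u where "u t = exp (- R t) * (x t * cos (\<theta> t) + y t * sin (\<theta> t))" for t
    define v where "v t = exp (- R t) * (y t * cos (\<theta> t) - x t * sin (\<theta> t))" for t
    \<comment> \<open>In complex notation the system reads z' = (\<kappa> + i \<omega>) z: \<kappa>
      is the rate of ln r and \<omega> the angular velocity.\<close>
    define \<kappa> where "\<kappa> t = - (y t)\<^sup>2 * \<phi> (x t, y t) / q t" for t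
    define \<omega> where "\<omega> t = - a t / q t" for t
    have x': "(x has_real_derivative \<kappa> t * x t - \<omega> t * y t) (at t)" for t
    proof -
      have "(\<kappa> t * x t - \<omega> t * y t) * q t = y t * q t"
        using q[of t] by (simp add: \<kappa>_def \<omega>_def a_def field_simps power2_eq_square)
      then show ?thesis using x_deriv[of t] q[of t] by simp
    qed
    have y': "(y has_real_derivative \<kappa> t * y t + \<omega> t * x t) (at t)" for t
    proof -
      have "(\<kappa> t * y t + \<omega> t * x t) * q t = - (y t)\<^sup>2 * \<phi> (x t, y t) * y t - a t * x t"
        using q[of t] by (simp add: \<kappa>_def \<omega>_def field_simps)
      also have "\<dots> = (- x t - y t * \<phi> (x t, y t)) * q t"
        by (simp add: a_def q_def algebra_simps power2_eq_square)
      finally have "\<kappa> t * y t + \<omega> t * x t = - x t - y t * \<phi> (x t, y t)"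
        using q[of t] by simp
      then show ?thesis using y_deriv[of t] by simp
    qed
    note polar_deriv = x' y' R_deriv[folded \<kappa>_def] \<theta>_deriv[folded \<omega>_def]
    have "(u has_real_derivative 0) (at t)" for t
      unfolding u_def
      by (rule derivative_eq_intros polar_deriv refl | simp)+ (simp add: algebra_simps)
    then have "u t = u 0" by (intro DERIV_isconst_all) blast
    moreover have "(v has_real_derivative 0) (at t)" for t
      unfolding v_def
      by (rule derivative_eq_intros polar_deriv refl | simp)+ (simp add: algebra_simps)
    then have "v t = v 0" by (intro DERIV_isconst_all) blast
    moreover have "u 0 = exp (- R 0) * exp (R 0) * (cos \<alpha> * cos \<alpha> + sin \<alpha> * sin \<alpha>)"
      by (simp add: u_def \<alpha> \<theta>_def algebra_simps del: sin_cos_squared_add3)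
    then have "u 0 = 1" by (simp add: exp_minus)
    moreover have "v 0 = 0" by (simp add: v_def \<alpha> \<theta>_def)
    ultimately have "u t = 1" "v t = 0" by simp_all
    then have uv: "x t * cos (\<theta> t) + y t * sin (\<theta> t) = exp (R t)"
      "y t * cos (\<theta> t) = x t * sin (\<theta> t)"
      by (simp_all add: u_def v_def exp_minus divide_simps)
    have sc: "cos (\<theta> t) * cos (\<theta> t) + sin (\<theta> t) * sin (\<theta> t) = 1" by simp
    show "x t = exp (R t) * cos (\<theta> t)" "y t = exp (R t) * sin (\<theta> t)"
      using unrotate[OF sc uv] by simp_all
  qed
  have a_polar: "a t / q t = 1 + sin (\<theta> t) * cos (\<theta> t) * \<phi> (x t, y t)" for t
    using q[of t] unfolding a_def by (simp add: xy_polar field_simps flip: expR)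
  have R_periodic: "R (t + T) = R t" for t
    by (simp add: R_def q_def x_periodic y_periodic)
  have \<theta>_decreasing: "\<theta> t < \<theta> s" if "s < t" for s t
    using that q a by (intro DERIV_neg_imp_decreasing[of s t \<theta>]) (auto intro!: exI[of _ "- a _ / q _"] \<theta>_deriv)
  have \<theta>_diff: "\<theta> (t + T) - \<theta> t = \<theta> T - \<theta> 0" for t
  proof -
    have "((\<lambda>t. \<theta> (t + T) - \<theta> t) has_real_derivative 0) (at t)" for t
      by (rule derivative_eq_intros DERIV_chain2[OF \<theta>_deriv] \<theta>_deriv refl | simp)+
        (simp add: a_def q_def x_periodic y_periodic)
    then have "\<theta> (t + T) - \<theta> t = \<theta> (0 + T) - \<theta> 0" by (intro DERIV_isconst_all allI)
    then show ?thesis by simp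
  qed
  \<comment> \<open>The angles at times 0 and \<open>T\<close> have equal sine and cosine, so they
    differ by a multiple of 2 pi, negative because \<theta> decreases; \<open>N\<close> is minus
    that integer.\<close>
  obtain N :: nat where "N > 0" and N: "\<And>t. \<theta> (t + T) = \<theta> t - of_nat N * (2 * pi)"
  proof -
    have "sin (\<theta> T) = sin (\<theta> 0) \<and> cos (\<theta> T) = cos (\<theta> 0)"
      using xy_polar[of T] xy_polar[of 0] R_periodic[of 0] x_periodic[of 0] y_periodic[of 0] by auto
    then obtain k :: int where k: "\<theta> T = \<theta> 0 + 2 * pi * of_int k"
      using sin_cos_eq_iff by blast
    moreover have "\<theta> T < \<theta> 0" using \<theta>_decreasing T_pos by simp
    ultimately have "k < 0" by (simp add: mult_less_0_iff)
    then show thesis using that[of "nat (- k)"] \<theta>_diff k by (simp add: algebra_simps)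
  qed
  have shift_nat: "\<theta> (t + of_nat n * T) = \<theta> t - of_nat n * (of_nat N * (2 * pi))" for t n
  proof (induction n)
    case (Suc n)
    then show ?case using N[of "t + of_nat n * T"] by (simp add: algebra_simps)
  qed simp
  have "\<exists>t. \<theta> t = s" for s
  proof -
    \<comment> \<open>Enough periods forward and backward from time 0 enclose \<open>s\<close>
      between two values of \<theta>.\<close>
    obtain n :: nat where n: "of_nat n * (of_nat N * (2 * pi)) > \<bar>s - \<theta> 0\<bar>"
      using reals_Archimedean3[of "of_nat N * (2 * pi)"] \<open>N > 0\<close> by auto
    have "\<theta> (of_nat n * T) = \<theta> 0 - of_nat n * (of_nat N * (2 * pi))"
      "\<theta> (- (of_nat n * T)) = \<theta> 0 + of_nat n * (of_nat N * (2 * pi))"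
      using shift_nat[of 0 n] shift_nat[of "- (of_nat n * T)" n] by simp_all
    then have "\<theta> (of_nat n * T) \<le> s" "s \<le> \<theta> (- (of_nat n * T))"
      using n by (simp_all only: abs_less_iff) linarith+
    moreover have "- (of_nat n * T) \<le> of_nat n * T"
    proof -
      have "0 \<le> of_nat n * T" using T_pos by simp
      then show ?thesis by linarith
    qed
    ultimately show ?thesis
      using IVT2'[of \<theta> "of_nat n * T" s "- (of_nat n * T)"] \<theta>_deriv
      by (meson DERIV_isCont continuous_at_imp_continuous_on)
  qed
  then obtain \<tau> where \<theta>\<tau>: "\<And>s. \<theta> (\<tau> s) = s" by metis
  have \<theta>_inj: "s = t" if "\<theta> s = \<theta> t" for s t
    using that \<theta>_decreasing by (metis less_irrefl linorder_cases)
  then have \<tau>\<theta>: "\<tau> (\<theta> t) = t" for t using \<theta>\<tau> by blast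
  have \<tau>_deriv: "(\<tau> has_real_derivative inverse (- a (\<tau> s) / q (\<tau> s))) (at s)" for s
  proof (rule DERIV_inverse_function[where f = \<theta> and g = \<tau> and a = "s - 1" and b = "s + 1"])
    have "isCont \<tau> (\<theta> (\<tau> s))"
      by (rule isCont_inverse_function2[of "\<tau> s - 1" _ "\<tau> s + 1"])
        (auto simp: \<tau>\<theta> intro: DERIV_isCont[OF \<theta>_deriv])
    then show "isCont \<tau> s" by (simp add: \<theta>\<tau>)
    show "- a (\<tau> s) / q (\<tau> s) \<noteq> 0" using a[of "\<tau> s"] q[of "\<tau> s"] by simp
    show "(\<theta> has_real_derivative - a (\<tau> s) / q (\<tau> s)) (at (\<tau> s))" by (rule \<theta>_deriv)
  qed (simp_all add: \<theta>\<tau>)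
  define \<rho> where "\<rho> s = R (\<tau> s)" for s
  have pt: "x (\<tau> s) = exp (\<rho> s) * cos s" "y (\<tau> s) = exp (\<rho> s) * sin s" for s
    using xy_polar[of "\<tau> s"] by (simp_all add: \<rho>_def \<theta>\<tau>)
  show thesis
  proof (rule that[of N \<rho>])
    show "N > 0" by fact
    show "\<forall>s. \<rho> (s + of_nat N * (2 * pi)) = \<rho> s"
    proof
      fix s
      \<comment> \<open>Since \<theta> decreases, raising the angle by \<open>N\<close> turns moves
        time back by \<open>T\<close>.\<close>
      have "\<theta> (\<tau> (s + of_nat N * (2 * pi)) + T) = \<theta> (\<tau> s)" by (simp add: N \<theta>\<tau>)
      then show "\<rho> (s + of_nat N * (2 * pi)) = \<rho> s"
        using \<theta>_inj R_periodic unfolding \<rho>_def by metis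
    qed
    have "range (\<lambda>s. (exp (\<rho> s) * cos s, exp (\<rho> s) * sin s)) = (\<lambda>t. (x t, y t)) ` range \<tau>"
      by (simp add: image_image pt)
    also have "range \<tau> = UNIV" using \<tau>\<theta> by (metis surj_def)
    finally show "range (\<lambda>t. (x t, y t)) = range (\<lambda>s. (exp (\<rho> s) * cos s, exp (\<rho> s) * sin s))" by simp
    show "polar_solution \<rho>"
      unfolding polar_solution_def
    proof (intro allI conjI)
      fix s
      have p: "polar (\<rho> s) s = \<phi> (x (\<tau> s), y (\<tau> s))" by (simp add: pt polar_def)
      have den: "1 + sin s * cos s * polar (\<rho> s) s = a (\<tau> s) / q (\<tau> s)"
        by (simp add: a_polar \<theta>\<tau> p)
      show "1 + sin s * cos s * polar (\<rho> s) s > 0"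
        unfolding den using a q by simp
      have "(\<rho> has_real_derivative - (y (\<tau> s))\<^sup>2 * \<phi> (x (\<tau> s), y (\<tau> s)) / q (\<tau> s)
          * inverse (- a (\<tau> s) / q (\<tau> s))) (at s)"
        unfolding \<rho>_def by (rule DERIV_chain2[OF R_deriv \<tau>_deriv])
      moreover have "(y (\<tau> s))\<^sup>2 = q (\<tau> s) * (sin s)\<^sup>2"
        by (simp add: pt(2) \<rho>_def power_mult_distrib power2_eq_square[of "exp _"] expR)
      then have "- (y (\<tau> s))\<^sup>2 * \<phi> (x (\<tau> s), y (\<tau> s)) / q (\<tau> s) * inverse (- a (\<tau> s) / q (\<tau> s))
          = (sin s)\<^sup>2 * \<phi> (x (\<tau> s), y (\<tau> s)) / (a (\<tau> s) / q (\<tau> s))"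
        using q[of "\<tau> s"] a[of "\<tau> s"] by (simp add: field_simps)
      ultimately show "(\<rho> has_real_derivative (sin s)\<^sup>2 * polar (\<rho> s) s /
          (1 + sin s * cos s * polar (\<rho> s) s)) (at s)"
        unfolding den unfolding p by (simp only:)
    qed
  qed
qed

end

section \<open>Comparison of two closed orbits\<close>

lemma (in star_shaped_damping) closed_orbit_unique:
  assumes "closed_orbit \<phi> \<phi>' \<sigma> x1 y1 T1" and "closed_orbit \<phi> \<phi>' \<sigma> x2 y2 T2"
  shows "range (\<lambda>t. (x1 t, y1 t)) = range (\<lambda>t. (x2 t, y2 t))"
proof -
  obtain \<rho>1 and N1 :: nat where 1: "N1 > 0"
      "\<forall>s. \<rho>1 (s + of_nat N1 * (2 * pi)) = \<rho>1 s"
      "range (\<lambda>t. (x1 t, y1 t)) = range (\<lambda>s. (exp (\<rho>1 s) * cos s, exp (\<rho>1 s) * sin s))"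
    and "polar_solution \<rho>1"
    using closed_orbit.polar_graph[OF assms(1)] .
  obtain \<rho>2 and N2 :: nat where 2: "N2 > 0"
      "\<forall>s. \<rho>2 (s + of_nat N2 * (2 * pi)) = \<rho>2 s"
      "range (\<lambda>t. (x2 t, y2 t)) = range (\<lambda>s. (exp (\<rho>2 s) * cos s, exp (\<rho>2 s) * sin s))"
    and "polar_solution \<rho>2"
    using closed_orbit.polar_graph[OF assms(2)] .
  then have der: "\<And>s. (\<rho>1 has_real_derivative
        (sin s)\<^sup>2 * polar (\<rho>1 s) s / (1 + sin s * cos s * polar (\<rho>1 s) s)) (at s)"
      "\<And>s. (\<rho>2 has_real_derivative
        (sin s)\<^sup>2 * polar (\<rho>2 s) s / (1 + sin s * cos s * polar (\<rho>2 s) s)) (at s)"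
    and den1: "\<And>s. 1 + sin s * cos s * polar (\<rho>1 s) s > 0"
    and den2: "\<And>s. 1 + sin s * cos s * polar (\<rho>2 s) s > 0"
    using \<open>polar_solution \<rho>1\<close> by (simp_all add: polar_solution_def)
  \<comment> \<open>A common period of \<open>\<rho>1\<close> and \<open>\<rho>2\<close>, whose
    numbers of turns may differ a priori.\<close>
  define P where "P = of_nat N1 * (of_nat N2 * (2 * pi))"
  have "P > 0" using 1(1) 2(1) by (simp add: P_def)
  define \<delta> where "\<delta> s = \<rho>1 s - \<rho>2 s" for s
  \<comment> \<open>The factor \<sigma> makes \<open>f\<close> nondecreasing for either sign of the
    radial derivative.\<close>
  define f where "f s = \<sigma> * (\<delta> s)\<^sup>2" for s
  define f' where "f' s = 2 * (sin s)\<^sup>2 * (\<sigma> * (polar (\<rho>1 s) s - polar (\<rho>2 s) s) * \<delta> s) /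
      ((1 + sin s * cos s * polar (\<rho>1 s) s) * (1 + sin s * cos s * polar (\<rho>2 s) s))" for s
  have f_deriv: "(f has_real_derivative f' s) (at s)" for s
  proof -
    have "(f has_real_derivative \<sigma> * (2 * \<delta> s * ((sin s)\<^sup>2 * polar (\<rho>1 s) s / (1 + sin s * cos s * polar (\<rho>1 s) s)
        - (sin s)\<^sup>2 * polar (\<rho>2 s) s / (1 + sin s * cos s * polar (\<rho>2 s) s)))) (at s)"
      unfolding f_def \<delta>_def by (rule derivative_eq_intros der refl | simp)+
    \<comment> \<open>Over the common denominator the terms in A B cancel, so the difference has the
      sign of A - B wherever sin s \<noteq> 0, whatever the sign of cos s.\<close>
    moreover have eq: "(sin s)\<^sup>2 * A / (1 + sin s * cos s * A) - (sin s)\<^sup>2 * B / (1 + sin s * cos s * B)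
        = (sin s)\<^sup>2 * (A - B) / ((1 + sin s * cos s * A) * (1 + sin s * cos s * B))"
      if "1 + sin s * cos s * A > 0" "1 + sin s * cos s * B > 0" for A B
      using that by (simp add: diff_frac_eq algebra_simps)
    have "\<sigma> * (2 * \<delta> s * ((sin s)\<^sup>2 * polar (\<rho>1 s) s / (1 + sin s * cos s * polar (\<rho>1 s) s)
        - (sin s)\<^sup>2 * polar (\<rho>2 s) s / (1 + sin s * cos s * polar (\<rho>2 s) s))) = f' s"
      unfolding eq[OF den1 den2] f'_def by simp
    ultimately show ?thesis by simp
  qed
  have den: "(1 + sin s * cos s * polar (\<rho>1 s) s) * (1 + sin s * cos s * polar (\<rho>2 s) s) > 0" for s
    using den1 den2 by simp
  have pos: "\<sigma> * (polar (\<rho>1 s) s - polar (\<rho>2 s) s) * \<delta> s > 0" if "\<delta> s \<noteq> 0" for s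
    using polar_mono[of "\<rho>1 s" "\<rho>2 s" s] that by (simp add: \<delta>_def)
  have f'_nonneg: "f' s \<ge> 0" for s
    using pos[of s] den[of s] unfolding f'_def
    by (cases "\<delta> s = 0") (auto intro!: divide_nonneg_pos mult_nonneg_nonneg)
  have "mono f"
    using f_deriv f'_nonneg by (intro monoI) (auto intro: DERIV_nonneg_imp_nondecreasing)
  moreover have "f (s + P) = f s" for s
  proof -
    have "\<rho>1 (s + P) = \<rho>1 s"
      using periodic_of_nat[of \<rho>1, OF 1(2)[rule_format], of s N2] by (simp add: P_def mult_ac)
    moreover have "\<rho>2 (s + P) = \<rho>2 s"
      using periodic_of_nat[of \<rho>2, OF 2(2)[rule_format], of s N1] by (simp add: P_def mult_ac)
    ultimately show ?thesis by (simp add: f_def \<delta>_def)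
  qed
  ultimately have f_const: "f s = f t" for s t
    using periodic_mono_const[of f P] \<open>P > 0\<close> by blast
  \<comment> \<open>At pi / 2 the factor sin^2 is 1, so a nonzero difference would give
    \<open>f\<close> a positive derivative, against constancy. At multiples of pi the derivative
    vanishes and says nothing.\<close>
  have "\<delta> (pi / 2) = 0"
  proof (rule ccontr)
    assume "\<delta> (pi / 2) \<noteq> 0"
    then have "f' (pi / 2) > 0"
      using pos[of "pi / 2"] den[of "pi / 2"] unfolding f'_def by simp
    moreover have "f = (\<lambda>_. f 0)" using f_const by blast
    then have "f' (pi / 2) = 0"
      using f_deriv[of "pi / 2"] DERIV_const DERIV_unique by metis
    ultimately show False by simp
  qed
  then have "f s = 0" for s using f_const[of s "pi / 2"] by (simp add: f_def)
  moreover have "\<sigma> \<noteq> 0" using radial[of "(1, 0)"] by auto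
  ultimately have "\<rho>1 = \<rho>2" by (simp add: f_def \<delta>_def fun_eq_iff)
  then show ?thesis using 1(3) 2(3) by simp
qed

section \<open>From the hypotheses on the plane to the locales\<close>

text \<open>The radial derivative is continuous and nowhere zero on the punctured plane, which is
  connected, so it keeps one sign there.\<close>

lemma star_shaped_dampingI:
  assumes "C1_on_plane \<phi>" and "strictly_star_shaped \<phi>"
  obtains \<phi>' \<sigma> where "star_shaped_damping \<phi> \<phi>' \<sigma>"
proof -
  obtain \<phi>' :: "real \<times> real \<Rightarrow> (real \<times> real) \<Rightarrow>\<^sub>L real"
    where der: "\<And>p. (\<phi> has_derivative blinfun_apply (\<phi>' p)) (at p)" and cont: "continuous_on UNIV \<phi>'"
    using assms(1) by (auto simp: C1_on_plane_def)
  define g where "g p = blinfun_apply (\<phi>' p) p" for p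
  have px: "partial_x \<phi> x y = \<phi>' (x, y) (1, 0)" for x y
  proof -
    have "((\<lambda>s. (s, y)) has_derivative (\<lambda>h. (h, 0))) (at x)"
      by (auto intro!: derivative_eq_intros)
    from has_derivative_compose[OF this der[of "(x, y)"]]
    have "((\<lambda>s. \<phi> (s, y)) has_real_derivative \<phi>' (x, y) (1, 0)) (at x)"
    proof (rule has_derivative_imp_has_field_derivative)
      show "h * \<phi>' (x, y) (1, 0) = \<phi>' (x, y) (h, 0)" for h
        using blinfun.scaleR_right[of "\<phi>' (x, y)" h "(1, 0)"] by simp
    qed
    then show ?thesis unfolding partial_x_def by (rule DERIV_imp_deriv)
  qed
  have py: "partial_y \<phi> x y = \<phi>' (x, y) (0, 1)" for x y
  proof -
    have "((\<lambda>s. (x, s)) has_derivative (\<lambda>h. (0, h))) (at y)"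
      by (auto intro!: derivative_eq_intros)
    from has_derivative_compose[OF this der[of "(x, y)"]]
    have "((\<lambda>s. \<phi> (x, s)) has_real_derivative \<phi>' (x, y) (0, 1)) (at y)"
    proof (rule has_derivative_imp_has_field_derivative)
      show "h * \<phi>' (x, y) (0, 1) = \<phi>' (x, y) (0, h)" for h
        using blinfun.scaleR_right[of "\<phi>' (x, y)" h "(0, 1)"] by simp
    qed
    then show ?thesis unfolding partial_y_def by (rule DERIV_imp_deriv)
  qed
  have g_eq: "g (x, y) = x * partial_x \<phi> x y + y * partial_y \<phi> x y" for x y
  proof -
    have "g (x, y) = \<phi>' (x, y) (x *\<^sub>R (1, 0) + y *\<^sub>R (0, 1))" by (simp add: g_def)
    then show ?thesis by (simp only: px py blinfun.add_right blinfun.scaleR_right real_scaleR_def)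
  qed
  have nz: "g p \<noteq> 0" if "p \<noteq> (0, 0)" for p
    using assms(2) that by (cases p) (auto simp: strictly_star_shaped_def g_eq)
  have "continuous_on (- {(0, 0)}) g"
    unfolding g_def by (intro continuous_intros continuous_on_subset[OF cont]) auto
  moreover have "connected (- {(0, 0)} :: (real \<times> real) set)"
    by (rule connected_punctured_universe) simp
  ultimately have conn: "connected (g ` (- {(0, 0)}))" by (rule connected_continuous_image)
  have same: "g q > 0" if "p \<noteq> (0, 0)" "q \<noteq> (0, 0)" "g p > 0" for p q
  proof (rule ccontr)
    assume "\<not> g q > 0"
    then have "0 \<in> g ` (- {(0, 0)})"
      using that by - (rule connectedD_interval[OF conn, of "g q" "g p"], auto)
    then show False using nz by (metis ComplD imageE singletonI)
  qed
  \<comment> \<open>Only the sign matters; any point other than the origin could be sampled.\<close>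
  define \<sigma> where "\<sigma> = g (1, 0)"
  have "\<sigma> * g p > 0" if "p \<noteq> (0, 0)" for p
    using same[OF that, of "(1, 0)"] same[of "(1, 0)" p] nz[OF that] nz[of "(1, 0)"] that
    by (auto simp: \<sigma>_def zero_less_mult_iff)
  then show thesis
    using that[of "\<lambda>p. blinfun_apply (\<phi>' p)" \<sigma>] der
    by (simp add: star_shaped_damping_def g_def)
qed

lemma (in star_shaped_damping) limit_cycle_closed_orbit:
  assumes "limit_cycle (planar_field \<phi>) C"
  obtains x y T where "closed_orbit \<phi> \<phi>' \<sigma> x y T" and "C = range (\<lambda>t. (x t, y t))"
proof -
  obtain z T where sol: "solution (planar_field \<phi>) z" and "T > 0" and per: "\<And>t. z (t + T) = z t"
    and nc: "\<not> z constant_on UNIV" and C: "C = range z"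
    using assms by (auto simp: limit_cycle_def periodic_def)
  define x y where "x = fst \<circ> z" and "y = snd \<circ> z"
  have z: "z t = (x t, y t)" for t by (simp add: x_def y_def)
  have d: "(z has_vector_derivative (y t, - x t - y t * \<phi> (x t, y t))) (at t)" for t
    using sol by (simp add: solution_def planar_field_def z)
  show thesis
  proof (rule that)
    have xd: "(x has_real_derivative y t) (at t)" for t
      using has_derivative_fst[OF d[of t, unfolded has_vector_derivative_def]]
      by (simp add: x_def o_def has_real_derivative_iff_has_vector_derivative has_vector_derivative_def)
    have yd: "(y has_real_derivative - x t - y t * \<phi> (x t, y t)) (at t)" for t
      using has_derivative_snd[OF d[of t, unfolded has_vector_derivative_def]]
      by (simp add: y_def o_def has_real_derivative_iff_has_vector_derivative has_vector_derivative_def)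
    have "(\<lambda>t. (x t, y t)) = z" by (simp add: z fun_eq_iff)
    then show "closed_orbit \<phi> \<phi>' \<sigma> x y T"
      using xd yd \<open>T > 0\<close> per nc by unfold_locales (auto simp: x_def y_def)
    show "C = range (\<lambda>t. (x t, y t))" by (simp add: C z)
  qed
qed

theorem theorem1:
  fixes \<phi> :: "real \<times> real \<Rightarrow> real"
  assumes "C1_on_plane \<phi>"
    and "strictly_star_shaped \<phi>"
  shows "\<exists>\<^sub>\<le>\<^sub>1 C. limit_cycle (planar_field \<phi>) C"
proof -
  obtain \<phi>' \<sigma> where "star_shaped_damping \<phi> \<phi>' \<sigma>"
    using star_shaped_dampingI[OF assms] .
  then interpret star_shaped_damping \<phi> \<phi>' \<sigma> .
  show ?thesis
  proof (rule Uniq_I)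
    fix C1 C2
    assume "limit_cycle (planar_field \<phi>) C1" "limit_cycle (planar_field \<phi>) C2"
    then obtain x1 y1 T1 x2 y2 T2
      where "closed_orbit \<phi> \<phi>' \<sigma> x1 y1 T1" "C1 = range (\<lambda>t. (x1 t, y1 t))"
        and "closed_orbit \<phi> \<phi>' \<sigma> x2 y2 T2" "C2 = range (\<lambda>t. (x2 t, y2 t))"
      using limit_cycle_closed_orbit by (metis (no_types))
    then show "C1 = C2" using closed_orbit_unique[of x1 y1 T1 x2 y2 T2] by simp
  qed
qed

end
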